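(* For any adjacent time-step ratios with $0<r_k\le r_s=1.405$, $k\ge2$, the quantities $p_j,q_j$ defined recursively in the context satisfy $$b_1^{(j)}+\mu_j\le q_j\le b_1^{(j)}+\nu_j\le 0,\qquad j\ge 3,$$ with $$\mu_j=\frac{\kappa_{\min}r_j^2r_{j-1}^4(1+r_j)}{\tau_j(1+r_{j-1})^2(1+r_{j-1}+r_jr_{j-1})},\qquad \nu_j=\frac{\kappa_{\max}r_j^2r_{j-1}^4(1+r_j)}{\tau_j(1+r_{j-1})^2(1+r_{j-1}+r_jr_{j-1})},$$ and $$\frac{\lambda_{\min}}{\tau_j}\le p_j\le\frac{\lambda_{\max}}{\tau_j},\qquad j\ge1,$$ where $\kappa_{\min}=0.25$, $\kappa_{\max}=1.4$, $\lambda_{\min}=1.99$, $\lambda_{\max}=3.99$.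
   Context: Let $\tau_1,\tau_2,\dots>0$ be time steps and $r_k=\tau_k/\tau_{k-1}$ for $k\ge2$. Define $$\widehat b_0^{(1)}=\frac{1.99}{\tau_1},\quad \widehat b_0^{(2)}=\frac{1.99+3.99r_2}{\tau_2(1+r_2)},\quad b_1^{(2)}=\frac{-r_2^2}{\tau_2(1+r_2)},$$ and for $n\ge3$ $$\widehat b_0^{(n)}=\frac{(1+r_{n-1})\left[1.99+3.99 r_n+r_{n-1}(1.99+7.98 r_n+5.99 r_n^2)\right]}{\tau_n(1+r_n)(1+r_{n-1})(1+r_{n-1}+r_nr_{n-1})},$$ $$b_1^{(n)}=-\frac{r_n^2\left[(1+2r_{n-1}+r_nr_{n-1})^2-r_{n-1}(1+r_{n-1})\right]}{\tau_n(1+r_n)(1+r_{n-1})(1+r_{n-1}+r_nr_{n-1})},$$ $$b_2^{(n)}=\frac{r_n^2r_{n-1}^3(1+r_n)^2}{\tau_n(1+r_n)(1+r_{n-1})(1+r_{n-1}+r_nr_{n-1})}.$$ The quantities $p_j,q_j$ are defined recursively by $$p_1=\widehat b_0^{(1)},\quad q_2=b_1^{(2)},\quad p_2=\widehat b_0^{(2)}-\frac{1}{p_1}q_2^2,$$ $$q_j=b_1^{(j)}-\frac{q_{j-1}}{p_{j-2}}b_2^{(j)},\qquad p_j=\widehat b_0^{(j)}-\frac{1}{p_{j-2}}\left(b_2^{(j)}\right)^2-\frac{1}{p_{j-1}}q_j^2,\qquad j\ge3$$ (that all $p_j\neq 0$, so that the recursion is well defined, is part of the assertion, as it follows from $p_j\ge\lambda_{\min}/\tau_j$).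 *)

theory Defs
  imports Complex_Main
begin

text \<open>
  A step sequence is a function \<open>\<tau> :: nat \<Rightarrow> real\<close>, of which only the values at indices
  \<open>k \<ge> 1\<close> matter.  The quantities below are likewise meaningful only on the following index ranges;
  elsewhere they take arbitrary values: \<open>ratio\<close> for \<open>k \<ge> 2\<close>, \<open>b0hat\<close> for \<open>n \<ge> 1\<close>, \<open>b1\<close> for
  \<open>n \<ge> 2\<close>, \<open>b2\<close>, \<open>mu\<close>, \<open>nu\<close> for \<open>n \<ge> 3\<close>, \<open>pseq\<close> for \<open>j \<ge> 1\<close>, \<open>qseq\<close> for \<open>j \<ge> 2\<close>.
\<close>

definition ratio :: "(nat \<Rightarrow> real) \<Rightarrow> nat \<Rightarrow> real" where
  "ratio \<tau> k = \<tau> k / \<tau> (k - 1)"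

definition b0hat :: "(nat \<Rightarrow> real) \<Rightarrow> nat \<Rightarrow> real" where
  "b0hat \<tau> n =
    (if n = 1 then 1.99 / \<tau> 1
     else if n = 2 then (1.99 + 3.99 * ratio \<tau> 2) / (\<tau> 2 * (1 + ratio \<tau> 2))
     else (let r = ratio \<tau> n; s = ratio \<tau> (n - 1) in
       (1 + s) * (1.99 + 3.99 * r + s * (1.99 + 7.98 * r + 5.99 * r\<^sup>2))
         / (\<tau> n * (1 + r) * (1 + s) * (1 + s + r * s))))"

definition b1 :: "(nat \<Rightarrow> real) \<Rightarrow> nat \<Rightarrow> real" where
  "b1 \<tau> n =
    (if n = 2 then - (ratio \<tau> 2)\<^sup>2 / (\<tau> 2 * (1 + ratio \<tau> 2))
     else (let r = ratio \<tau> n; s = ratio \<tau> (n - 1) in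
       - (r\<^sup>2 * ((1 + 2 * s + r * s)\<^sup>2 - s * (1 + s))
         / (\<tau> n * (1 + r) * (1 + s) * (1 + s + r * s)))))"

definition b2 :: "(nat \<Rightarrow> real) \<Rightarrow> nat \<Rightarrow> real" where
  "b2 \<tau> n =
    (let r = ratio \<tau> n; s = ratio \<tau> (n - 1) in
       r\<^sup>2 * s ^ 3 * (1 + r)\<^sup>2
         / (\<tau> n * (1 + r) * (1 + s) * (1 + s + r * s)))"

text \<open>
  In the last equation of each block, \<open>Suc (Suc (Suc m))\<close> is the index \<open>j \<ge> 3\<close>, so that
  \<open>Suc (Suc m)\<close> is \<open>j - 1\<close> and \<open>Suc m\<close> is \<open>j - 2\<close>.  Division is total in HOL; that the
  denominators do not vanish is a claim to be proved about \<open>pseq\<close>.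
\<close>

fun pseq :: "(nat \<Rightarrow> real) \<Rightarrow> nat \<Rightarrow> real"
  and qseq :: "(nat \<Rightarrow> real) \<Rightarrow> nat \<Rightarrow> real"
where
  "pseq \<tau> 0 = 0"
| "pseq \<tau> (Suc 0) = b0hat \<tau> 1"
| "pseq \<tau> (Suc (Suc 0)) = b0hat \<tau> 2 - 1 / pseq \<tau> (Suc 0) * (qseq \<tau> (Suc (Suc 0)))\<^sup>2"
| "pseq \<tau> (Suc (Suc (Suc m))) =
     b0hat \<tau> (Suc (Suc (Suc m)))
     - 1 / pseq \<tau> (Suc m) * (b2 \<tau> (Suc (Suc (Suc m))))\<^sup>2
     - 1 / pseq \<tau> (Suc (Suc m)) * (qseq \<tau> (Suc (Suc (Suc m))))\<^sup>2"
| "qseq \<tau> 0 = 0"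
| "qseq \<tau> (Suc 0) = 0"
| "qseq \<tau> (Suc (Suc 0)) = b1 \<tau> 2"
| "qseq \<tau> (Suc (Suc (Suc m))) =
     b1 \<tau> (Suc (Suc (Suc m)))
     - qseq \<tau> (Suc (Suc m)) / pseq \<tau> (Suc m) * b2 \<tau> (Suc (Suc (Suc m)))"

definition r_s :: real where "r_s = 1.405"
definition kappa_min :: real where "kappa_min = 0.25"
definition kappa_max :: real where "kappa_max = 1.4"
definition lambda_min :: real where "lambda_min = 1.99"
definition lambda_max :: real where "lambda_max = 3.99"

definition mu :: "(nat \<Rightarrow> real) \<Rightarrow> nat \<Rightarrow> real" where
  "mu \<tau> j =
    (let r = ratio \<tau> j; s = ratio \<tau> (j - 1) in
       kappa_min * r\<^sup>2 * s ^ 4 * (1 + r) / (\<tau> j * (1 + s)\<^sup>2 * (1 + s + r * s)))"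

definition nu :: "(nat \<Rightarrow> real) \<Rightarrow> nat \<Rightarrow> real" where
  "nu \<tau> j =
    (let r = ratio \<tau> j; s = ratio \<tau> (j - 1) in
       kappa_max * r\<^sup>2 * s ^ 4 * (1 + r) / (\<tau> j * (1 + s)\<^sup>2 * (1 + s + r * s)))"

end

theory Submission
  imports Defs
begin

text \<open>
  The time steps scale out: \<open>\<tau>\<^sub>j p\<^sub>j\<close> and \<open>\<tau>\<^sub>j q\<^sub>j\<close> obey a recursion in
  which only \<open>r = r\<^sub>j\<close> and \<open>s = r\<^bsub>j-1\<^esub>\<close> enter. The key observation is that the corrections
  \<open>\<mu>\<^sub>j\<close> and \<open>\<nu>\<^sub>j\<close> have the exact shape of the term which the recursion adds to \<open>b\<^sub>1\<close>. Write
  \<open>\<tau>\<^sub>j q\<^sub>j = - r\<^sup>2 / (1 + r) * g\<^sub>j\<close>. Then \<open>g\<^sub>2 = 1\<close>, and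
  \<open>g\<^sub>j = q_factor k r s\<close> with \<open>k = g\<^bsub>j-1\<^esub> / (\<tau>\<^bsub>j-2\<^esub> p\<^bsub>j-2\<^esub>)\<close>, while
  \<open>\<mu>\<^sub>j\<close> and \<open>\<nu>\<^sub>j\<close> correspond to \<open>k = \<kappa>\<^bsub>min\<^esub>\<close> and \<open>k = \<kappa>\<^bsub>max\<^esub>\<close> in the same formula.
  As \<open>q_factor\<close> decreases in \<open>k\<close>, the bounds on \<open>q\<^sub>j\<close> say exactly that
  \<open>\<kappa>\<^bsub>min\<^esub> \<le> k \<le> \<kappa>\<^bsub>max\<^esub>\<close>. This follows from \<open>\<lambda>\<^bsub>min\<^esub> \<le> \<tau>\<^bsub>j-2\<^esub> p\<^bsub>j-2\<^esub> \<le> \<lambda>\<^bsub>max\<^esub>\<close> and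
  \<open>1 \<le> g\<^bsub>j-1\<^esub> \<le> \<kappa>\<^bsub>max\<^esub> \<lambda>\<^bsub>min\<^esub>\<close>, because \<open>1 / 3.99 \<ge> 0.25\<close>. The bounds on \<open>g\<close> are
  inherited in turn: \<open>k \<le> \<kappa>\<^bsub>max\<^esub>\<close> gives the lower one (\<open>q_factor_ge_1\<close>) and
  \<open>k \<ge> \<kappa>\<^bsub>min\<^esub>\<close> the upper one (\<open>q_factor_le\<close>).

  It remains to keep the pivots \<open>\<tau>\<^sub>j p\<^sub>j\<close> in the interval from \<open>\<lambda>\<^bsub>min\<^esub>\<close> to \<open>\<lambda>\<^bsub>max\<^esub>\<close>
  (\<open>scaled_pivot_bounds\<close>). The diagonal entry \<open>b\<^sub>0\<close> exceeds \<open>\<lambda>\<^bsub>min\<^esub>\<close> by \<open>r\<close> times the quantity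
  \<open>2 / (1 + r) + 2 * s / (1 + s * (1 + r))\<close>, which decreases in \<open>r\<close>. The two terms subtracted
  from it, divided by \<open>r\<close> as well, increase in \<open>r\<close> if all unknowns are replaced by their
  extreme values. So the worst case is \<open>r = r\<^sub>s\<close>, and the lower bound on the pivot becomes
  the positivity of a polynomial of degree 8 in \<open>s\<close>, proved in \<open>pivot_margin_at_r_s\<close>. The relative
  margin at \<open>s = r\<^sub>s\<close> is tiny, so that 1.405 is nearly the largest ratio for which this argument works. The upper bound on the
  pivot has ample room: \<open>b\<^sub>0\<close> exceeds \<open>\<lambda>\<^bsub>max\<^esub>\<close> only if \<open>r > 1.3\<close> and \<open>s > 1\<close>, and there the subtracted
  term with \<open>q\<^sub>j\<close> is large enough (\<open>pivot_upper_margin\<close>).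
\<close>

section \<open>The scaled off-diagonal factor\<close>

text \<open>
  The value of \<open>- \<tau>\<^sub>j q\<^sub>j * (1 + r) / r\<^sup>2\<close> when \<open>q\<^sub>j\<close> is \<open>b\<^sub>1\<close> plus the correction that has
  coefficient \<open>k\<close> in place of \<open>\<kappa>\<^bsub>min\<^esub>\<close> or \<open>\<kappa>\<^bsub>max\<^esub>\<close>. The first summand 1 is the value for \<open>s = 0\<close>.
\<close>

definition q_factor :: "real \<Rightarrow> real \<Rightarrow> real \<Rightarrow> real" where
  "q_factor k r s =
     1 + s * (1 + r) * ((1 + s) * (1 + s * (2 + r)) - k * s ^ 3 * (1 + r))
         / ((1 + s)\<^sup>2 * (1 + s * (1 + r)))"

text \<open>
  The normal form of \<open>b\<^sub>1\<close> plus a correction. With \<open>D = 1 + s + r * s\<close> the numerator of \<open>b\<^sub>1\<close>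
  contains \<open>(D + s)\<^sup>2 - s * (1 + s)\<close>, from which \<open>(1 + s) * D\<close> splits off, leaving
  \<open>s * (1 + r) * (1 + s * (2 + r))\<close>.
\<close>

lemma b1_plus_correction:
  assumes "r > 0" "s > 0" "t \<noteq> (0::real)"
  shows "- (r\<^sup>2 * ((1 + 2 * s + r * s)\<^sup>2 - s * (1 + s)) / (t * (1 + r) * (1 + s) * (1 + s + r * s)))
           + k * r\<^sup>2 * s ^ 4 * (1 + r) / (t * (1 + s)\<^sup>2 * (1 + s + r * s))
         = - (r\<^sup>2 / (1 + r)) * q_factor k r s / t"
proof -
  define D where "D = 1 + s + r * s"
  have pos: "1 + r \<noteq> 0" "1 + s \<noteq> 0" "D \<noteq> 0"
    using assms by (simp_all add: D_def add_pos_pos less_imp_neq[symmetric])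
  have D': "1 + s * (1 + r) = D" by (simp add: D_def algebra_simps)
  have "- (r\<^sup>2 * ((1 + 2 * s + r * s)\<^sup>2 - s * (1 + s)) / (t * (1 + r) * (1 + s) * D))
           + k * r\<^sup>2 * s ^ 4 * (1 + r) / (t * (1 + s)\<^sup>2 * D)
     = r\<^sup>2 * (- ((1 + s) * ((1 + 2 * s + r * s)\<^sup>2 - s * (1 + s))) + k * s ^ 4 * (1 + r)\<^sup>2) / (t * (1 + r) * (1 + s)\<^sup>2 * D)"
    using pos assms(3) by (simp add: divide_simps) algebra
  moreover have "- (r\<^sup>2 / (1 + r)) * q_factor k r s / t
     = - (r\<^sup>2 * ((1 + s)\<^sup>2 * D + s * (1 + r) * ((1 + s) * (1 + s * (2 + r)) - k * s ^ 3 * (1 + r)))) / (t * (1 + r) * (1 + s)\<^sup>2 * D)"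
    using pos assms(3) unfolding q_factor_def D' by (simp add: divide_simps)
  moreover have "(1 + s) * ((1 + 2 * s + r * s)\<^sup>2 - s * (1 + s)) - k * s ^ 4 * (1 + r)\<^sup>2
     = (1 + s)\<^sup>2 * D + s * (1 + r) * ((1 + s) * (1 + s * (2 + r)) - k * s ^ 3 * (1 + r))"
    unfolding D_def by algebra
  ultimately show ?thesis
    unfolding D_def[symmetric]
    by (smt (verit) mult_minus_right)
qed

lemma q_factor_antimono:
  assumes "r > 0" "s > 0" "k \<le> l"
  shows "q_factor l r s \<le> q_factor k r s"
  unfolding q_factor_def using assms
  by (auto intro!: add_left_mono divide_right_mono mult_left_mono diff_left_mono mult_right_mono)

text \<open>
  The lower half of the invariant on \<open>g\<close>. It is also the sign condition
  \<open>b\<^sub>1 + \<nu> \<le> 0\<close>, since \<open>k = \<kappa>\<^bsub>max\<^esub>\<close> is allowed. After cancellation the claim is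
  \<open>1.4 * s ^ 3 * (1 + r) \<le> (1 + s) * (1 + s * (2 + r))\<close>, where \<open>1.4 * s\<^sup>2 \<le> 2.8\<close>
  makes the left-hand side linear in \<open>s\<close>.
\<close>

lemma q_factor_ge_1:
  assumes "0 < r" "r \<le> r_s" "0 < s" "s \<le> r_s" "k \<le> kappa_max"
  shows "1 \<le> q_factor k r s"
proof -
  have "s\<^sup>2 \<le> 1.405\<^sup>2" using assms unfolding r_s_def by (intro power_mono) auto
  then have "1.4 * s\<^sup>2 \<le> 2.8" by (simp add: power2_eq_square)
  then have "1.4 * s\<^sup>2 * (s * (1 + r)) \<le> 2.8 * (s * (1 + r))"
    using assms by (intro mult_right_mono) auto
  then have *: "1.4 * s ^ 3 * (1 + r) \<le> 2.8 * (s * (1 + r))"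
    by (simp add: power3_eq_cube power2_eq_square mult_ac)
  \<comment> \<open>The difference of the two sides, \<open>1 + 0.2 * s + 2 * s\<^sup>2 - r * s * (1.8 - s)\<close>, is smallest for
    \<open>r = 1.405\<close>; 0.34 is close to the minimum of the resulting quadratic in \<open>s\<close>.\<close>
  have "r * (s * (1.8 - s)) \<le> 1.405 * (s * (1.8 - s))"
    using assms unfolding r_s_def by (intro mult_right_mono mult_nonneg_nonneg) auto
  moreover have "(s - 0.34)\<^sup>2 \<ge> 0" by simp
  moreover have "s \<le> 1.405" using assms by (simp add: r_s_def)
  ultimately have "2.8 * (s * (1 + r)) \<le> (1 + s) * (1 + s * (2 + r))"
    by (simp add: power2_eq_square algebra_simps)
  with * have "1.4 * s ^ 3 * (1 + r) \<le> (1 + s) * (1 + s * (2 + r))" by linarith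
  then have "1 \<le> q_factor kappa_max r s"
    using assms unfolding q_factor_def kappa_max_def by (auto intro!: divide_nonneg_pos mult_nonneg_nonneg mult_pos_pos add_pos_pos)
  also have "\<dots> \<le> q_factor k r s" using assms by (intro q_factor_antimono) auto
  finally show ?thesis .
qed

text \<open>
  Both the quotient \<open>(1 + r) / (1 + s * (1 + r))\<close> and its cofactor in \<open>q_factor\<close> increase in \<open>r\<close>.
  The cofactor is affine in \<open>r\<close> with slope \<open>s * (1 + s - s\<^sup>2 / 4)\<close>, nonnegative for \<open>s \<le> r\<^sub>s\<close>.
\<close>

lemma q_factor_mono_ratio:
  assumes "0 < r" "r \<le> r'" "0 < s" "s \<le> r_s"
  shows "q_factor kappa_min r s \<le> q_factor kappa_min r' s"
proof -
  have "s\<^sup>2 \<le> 1.405 * s"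
    unfolding power2_eq_square using assms by (intro mult_right_mono) (simp_all add: r_s_def)
  then have "0 \<le> 1 + s - 0.25 * s\<^sup>2"
    using assms by (simp add: field_simps)
  then have base: "0 \<le> s * (1 + s - 0.25 * s\<^sup>2)"
    using assms by simp
  define c where "c u = (1 + s)\<^sup>2 + s * (1 + s - 0.25 * s\<^sup>2) * (1 + u)" for u
  have q: "q_factor kappa_min u s = 1 + s / (1 + s)\<^sup>2 * ((1 + u) / (1 + s * (1 + u)) * c u)" for u
  proof -
    have "(1 + s) * (1 + s * (2 + u)) - kappa_min * s ^ 3 * (1 + u) = c u"
      by (simp add: c_def kappa_min_def field_simps power2_eq_square power3_eq_cube)
    then show ?thesis by (simp add: q_factor_def)
  qed
  have "(1 + r) / (1 + s * (1 + r)) \<le> (1 + r') / (1 + s * (1 + r'))"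
    using assms by (simp add: divide_simps add_pos_pos algebra_simps)
  moreover have "c r \<le> c r'"
    unfolding c_def using base assms by (intro add_left_mono mult_left_mono) auto
  moreover have "0 \<le> c r"
    unfolding c_def using base assms by (intro add_nonneg_nonneg mult_nonneg_nonneg[of "_ * _"]) auto
  ultimately have "(1 + r) / (1 + s * (1 + r)) * c r \<le> (1 + r') / (1 + s * (1 + r')) * c r'"
    using assms by (intro mult_mono) (auto intro!: divide_nonneg_pos add_pos_pos)
  then show ?thesis unfolding q using assms by (intro add_left_mono mult_left_mono) auto
qed

text \<open>
  The upper half of the invariant on \<open>g\<close>: monotonicity reduces it to \<open>k = \<kappa>\<^bsub>min\<^esub>\<close> and \<open>r = r\<^sub>s\<close>,
  where it is the nonnegativity of a quartic in \<open>s\<close>.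
\<close>

lemma q_factor_le:
  assumes "0 < r" "r \<le> r_s" "0 < s" "s \<le> r_s" "kappa_min \<le> k"
  shows "q_factor k r s \<le> kappa_max * lambda_min"
proof -
  have s: "0 \<le> s" "s \<le> 1.405" using assms by (simp_all add: r_s_def)
  have "s ^ 2 \<le> 1.405 * s" using mult_right_mono[OF s(2) s(1)] by (simp add: power2_eq_square)
  moreover have "s ^ 3 \<le> 1.405\<^sup>2 * s"
    using mult_right_mono[OF power_mono[OF s(2) s(1), of 2] s(1)] by (simp add: power2_eq_square power3_eq_cube mult_ac)
  \<comment> \<open>The positive term with \<open>s ^ 4\<close> cannot be dropped; \<open>s ^ 4\<close> is bounded below by \<open>s\<^sup>2\<close> times
    the tangent of \<open>s\<^sup>2\<close> at 1.1.\<close>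
  moreover have "0 \<le> (s * (s - 1.1))\<^sup>2" by simp
  then have "2.2 * s ^ 3 - 1.21 * s ^ 2 \<le> s ^ 4"
    by (simp add: power2_eq_square power3_eq_cube power4_eq_xxxx algebra_simps)
  \<comment> \<open>The difference of the two sides of the inequality that follows, multiplied out;
    1.786 is \<open>\<kappa>\<^bsub>max\<^esub> * \<lambda>\<^bsub>min\<^esub> - 1\<close>.\<close>
  ultimately have "0 \<le> 1.786 + 5.46233 * s - 0.217365 * s ^ 2 - 3.893695 * s ^ 3 + 1.44600625 * s ^ 4"
    using s by (simp add: power_divide)
  then have "s * 2.405 * ((1 + s) * (1 + s * 3.405) - 0.25 * s ^ 3 * 2.405)
      \<le> 1.786 * ((1 + s)\<^sup>2 * (1 + s * 2.405))"
    by (simp add: power2_eq_square power3_eq_cube power4_eq_xxxx field_simps)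
  then have "q_factor kappa_min r_s s \<le> kappa_max * lambda_min"
    using assms s unfolding q_factor_def r_s_def kappa_min_def kappa_max_def lambda_min_def
    by (simp add: add_pos_nonneg divide_le_eq)
  moreover have "q_factor kappa_min r s \<le> q_factor kappa_min r_s s"
    using assms by (intro q_factor_mono_ratio) auto
  moreover have "q_factor k r s \<le> q_factor kappa_min r s"
    using assms by (intro q_factor_antimono) auto
  ultimately show ?thesis by linarith
qed

section \<open>Bounds on the scaled pivots\<close>

text \<open>
  The critical case of the lower bound on the pivots. After multiplication by the denominators it
  says that a polynomial of degree 8 in \<open>s\<close> is nonnegative on the interval from 0 to 1.405. Its coefficients up
  to \<open>s ^ 4\<close> are positive and the others negative. So its quotient by \<open>s ^ 4\<close> decreases for
  \<open>s > 0\<close>, and the value at the right end point, which is just positive, decides. Comparing every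
  power of \<open>s\<close> with \<open>s ^ 4\<close> expresses this argument linearly.
\<close>

lemma pivot_margin_at_r_s:
  assumes "0 < s" "s \<le> r_s"
  shows "(r_s * (1 + r_s) / (1 + s * (1 + r_s)))\<^sup>2 * s ^ 5 / (1 + s)\<^sup>2
          + (r_s / (1 + r_s) * q_factor kappa_min r_s s)\<^sup>2
         \<le> lambda_min * (2 / (1 + r_s) + 2 * s / (1 + s * (1 + r_s)))"
proof -
  define D where "D = 1 + s * 2.405"
  define N where "N = (1 + s)\<^sup>2 * D + s * 2.405 * ((1 + s) * (1 + s * 3.405) - 0.25 * s ^ 3 * 2.405)"
  have Dpos: "D > 0" "1 + s > 0" using assms unfolding D_def by (auto intro!: add_pos_pos)
  have s: "0 \<le> s" "s \<le> 1.405" using assms by (simp_all add: r_s_def)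
  have hi: "s ^ (4 + i) \<le> 1.405 ^ i * s ^ 4" for i
    unfolding power_add mult.commute[of "s ^ 4"] using s by (intro mult_right_mono power_mono) auto
  have lo: "s ^ 4 \<le> 1.405 ^ i * s ^ (4 - i)" if "i \<le> 4" for i
    using power_mono[OF s(2) s(1), of i] s that
    by (metis le_add_diff_inverse mult_right_mono power_add zero_le_power)
  have lo4: "s ^ 4 \<le> 3.9"
    using power_mono[OF s(2) s(1), of 4] by (rule order_trans) (simp add: power_divide)
  \<comment> \<open>The coefficients are those of the exact polynomial, rounded down slightly.\<close>
  have "0 \<le> 7.597 + 80.46 * s + 288.09 * s ^ 2 + 412.7 * s ^ 3 + 139.867 * s ^ 4
       - 201.3 * s ^ 5 - 149.257 * s ^ 6 - 5.561 * s ^ 7 - 4.128 * s ^ 8"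
    using hi[of 1] hi[of 2] hi[of 3] hi[of 4] lo[of 1] lo[of 2] lo[of 3] lo4 s
      zero_le_power[OF s(1), of 4]
    by (simp add: power_divide)
  also have "\<dots> \<le> 1.99 * 2.405 * (2 + 4 * s * 2.405) * (1 + s) ^ 4 * D
     - (2.405\<^sup>2 * (1.405\<^sup>2 * s ^ 5 * 2.405\<^sup>2 * (1 + s)\<^sup>2) + 1.405\<^sup>2 * N\<^sup>2)"
    (is "?l \<le> ?r")
  proof -
    \<comment> \<open>The rounding errors of the coefficients.\<close>
    have "?r - ?l = 0.000875 + 0.002638 * s + 0.00316009125 * s ^ 2 + 0.0000485412375 * s ^ 3
       + 0.000446851861234375 * s ^ 4 + 0.000383176599328125 * s ^ 5 + 0.0009716061468359375 * s ^ 6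
       + 0.0003838314212421875 * s ^ 7 + 0.0004438625210146484375 * s ^ 8"
      unfolding N_def D_def by (simp add: eval_nat_numeral field_simps)
    moreover have "0 \<le> 0.000875 + 0.002638 * s + 0.00316009125 * s ^ 2 + 0.0000485412375 * s ^ 3
       + 0.000446851861234375 * s ^ 4 + 0.000383176599328125 * s ^ 5 + 0.0009716061468359375 * s ^ 6
       + 0.0003838314212421875 * s ^ 7 + 0.0004438625210146484375 * s ^ 8"
      using s by (intro add_nonneg_nonneg) auto
    ultimately show ?thesis by linarith
  qed
  finally have key: "2.405\<^sup>2 * (1.405\<^sup>2 * s ^ 5 * 2.405\<^sup>2 * (1 + s)\<^sup>2) + 1.405\<^sup>2 * N\<^sup>2
        \<le> 1.99 * 2.405 * (2 + 4 * s * 2.405) * (1 + s) ^ 4 * D"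
    by linarith
  define x y :: real where "x = 2.405" and "y = 1.405"
  have xpos: "x > 0" by (simp add: x_def)
  have g: "q_factor kappa_min r_s s = N / ((1 + s)\<^sup>2 * D)"
  proof -
    have "q_factor kappa_min r_s s
        = 1 + s * 2.405 * ((1 + s) * (1 + s * 3.405) - 0.25 * s ^ 3 * 2.405) / ((1 + s)\<^sup>2 * D)"
      by (simp add: q_factor_def r_s_def kappa_min_def D_def)
    then show ?thesis
      using Dpos unfolding N_def add_divide_distrib by simp
  qed
  have rs: "r_s = y" "1 + y = x" "1 + s * x = D" "lambda_min = 1.99"
    by (simp_all add: r_s_def x_def y_def D_def lambda_min_def)
  have "(y * x / D)\<^sup>2 * s ^ 5 / (1 + s)\<^sup>2 + (y / x * (N / ((1 + s)\<^sup>2 * D)))\<^sup>2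
     = (x\<^sup>2 * (y\<^sup>2 * s ^ 5 * x\<^sup>2 * (1 + s)\<^sup>2) + y\<^sup>2 * N\<^sup>2) / (x\<^sup>2 * (1 + s) ^ 4 * D\<^sup>2)"
    using Dpos xpos by (simp add: divide_simps power_mult_distrib power_divide) (simp add: algebra_simps eval_nat_numeral)
  also have "\<dots> \<le> 1.99 * x * (2 + 4 * s * x) * (1 + s) ^ 4 * D / (x\<^sup>2 * (1 + s) ^ 4 * D\<^sup>2)"
    using key Dpos xpos unfolding x_def y_def by (intro divide_right_mono) auto
  also have "\<dots> = 1.99 * ((2 + 4 * s * x) / (x * D))"
    using Dpos xpos by (simp add: divide_simps power2_eq_square)
  also have "(2 + 4 * s * x) / (x * D) = 2 / x + 2 * s / D"
    using Dpos xpos by (simp add: divide_simps) (simp add: D_def x_def algebra_simps)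
  finally show ?thesis unfolding rs g[unfolded rs(1)] .
qed

text \<open>Every term on the left increases in \<open>r\<close> and every term on the right decreases.\<close>

lemma pivot_margin:
  assumes "0 < r" "r \<le> r_s" "0 < s" "s \<le> r_s"
  shows "(r * (1 + r) / (1 + s * (1 + r)))\<^sup>2 * s ^ 5 / (1 + s)\<^sup>2
          + (r / (1 + r) * q_factor kappa_min r s)\<^sup>2
         \<le> lambda_min * (2 / (1 + r) + 2 * s / (1 + s * (1 + r)))"
proof -
  have rs0: "r_s > 0" by (simp add: r_s_def)
  have Dpos: "0 < 1 + s * (1 + u)" if "u > 0" for u using assms that by (intro add_pos_pos) auto
  have Dle: "1 + s * (1 + r) \<le> 1 + s * (1 + r_s)" using assms by simp
  have q1: "1 \<le> q_factor kappa_min r s"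
    using assms by (intro q_factor_ge_1) (auto simp: kappa_min_def kappa_max_def)
  have "r * (1 + r) / (1 + s * (1 + r)) \<le> r_s * (1 + r_s) / (1 + s * (1 + r_s))"
  proof -
    have "(1 + r) / (1 + s * (1 + r)) \<le> (1 + r_s) / (1 + s * (1 + r_s))"
      using assms rs0 by (simp add: divide_simps add_pos_pos algebra_simps)
    then have "r * ((1 + r) / (1 + s * (1 + r))) \<le> r_s * ((1 + r_s) / (1 + s * (1 + r_s)))"
      using assms rs0 Dpos[of r] by (intro mult_mono) auto
    then show ?thesis by simp
  qed
  then have 1: "(r * (1 + r) / (1 + s * (1 + r)))\<^sup>2 * s ^ 5 / (1 + s)\<^sup>2
       \<le> (r_s * (1 + r_s) / (1 + s * (1 + r_s)))\<^sup>2 * s ^ 5 / (1 + s)\<^sup>2"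
    using assms Dpos[of r] by (intro divide_right_mono mult_right_mono power_mono) auto
  have "r / (1 + r) \<le> r_s / (1 + r_s)"
    using assms rs0 by (simp add: divide_simps algebra_simps)
  then have "r / (1 + r) * q_factor kappa_min r s \<le> r_s / (1 + r_s) * q_factor kappa_min r_s s"
    using assms rs0 q1 by (intro mult_mono q_factor_mono_ratio) auto
  then have 2: "(r / (1 + r) * q_factor kappa_min r s)\<^sup>2 \<le> (r_s / (1 + r_s) * q_factor kappa_min r_s s)\<^sup>2"
    using assms q1 by (intro power_mono) auto
  have "2 / (1 + r_s) \<le> 2 / (1 + r)" "2 * s / (1 + s * (1 + r_s)) \<le> 2 * s / (1 + s * (1 + r))"
    using assms rs0 Dle mult_pos_pos[OF Dpos[of r_s] Dpos[of r]] by (intro divide_left_mono; simp)+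
  then have "lambda_min * (2 / (1 + r_s) + 2 * s / (1 + s * (1 + r_s)))
       \<le> lambda_min * (2 / (1 + r) + 2 * s / (1 + s * (1 + r)))"
    by (intro mult_left_mono add_mono) (auto simp: lambda_min_def)
  with 1 2 pivot_margin_at_r_s[OF assms(3,4)] show ?thesis by linarith
qed

text \<open>
  The left-hand side is the excess of the scaled \<open>b\<^sub>0\<close> over \<open>\<lambda>\<^bsub>max\<^esub>\<close>, the right-hand side the least
  possible contribution of the term with \<open>q\<^sub>j\<^sup>2\<close>, for \<open>g\<^sub>j = 1\<close> and the largest pivot.
  If the excess is positive then \<open>r\<^sup>2 - 1\<close> must exceed \<open>1 / 1.405\<close>, and \<open>s\<close> must exceed \<open>1 / 0.975\<close>;
  in that corner constant bounds suffice.
\<close>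

lemma pivot_upper_margin:
  assumes "0 < r" "r \<le> r_s" "0 < s" "s \<le> r_s"
  shows "2 * (r\<^sup>2 * s - 1 - s) / ((1 + r) * (1 + s * (1 + r))) \<le> r ^ 3 / (lambda_max * (1 + r)\<^sup>2)"
proof -
  have r: "0 \<le> r" "r \<le> 1.405" and s: "0 \<le> s" "s \<le> 1.405" using assms by (simp_all add: r_s_def)
  define D where "D = 1 + s * (1 + r)"
  have D: "D > 0" using assms unfolding D_def by (intro add_pos_pos) auto
  define A where "A = s * (r\<^sup>2 - 1) - 1"
  have "lambda_max * (2 * A * (1 + r)) \<le> r ^ 3 * D"
  proof (cases "A \<le> 0")
    case True
    then have "lambda_max * (2 * A * (1 + r)) \<le> 0"
      using r by (intro mult_nonneg_nonpos mult_nonpos_nonneg) (auto simp: lambda_max_def)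
    moreover have "0 \<le> r ^ 3 * D" using r D by simp
    ultimately show ?thesis by linarith
  next
    case False
    then have "0 < s * (r\<^sup>2 - 1)" by (simp add: A_def)
    then have r2: "0 < r\<^sup>2 - 1" using s by (simp add: zero_less_mult_iff)
    have r2': "r\<^sup>2 - 1 \<le> 0.975" using power_mono[OF r(2,1), of 2] by (simp add: power_divide)
    have "s * (r\<^sup>2 - 1) \<le> 1.405 * (r\<^sup>2 - 1)"
      using s(2) less_imp_le[OF r2] by (rule mult_right_mono)
    moreover have "s * (r\<^sup>2 - 1) \<le> s * 0.975"
      using r2' s(1) by (rule mult_left_mono)
    ultimately have bounds: "A \<le> 0.37" "1.71 \<le> r\<^sup>2" "1.02 \<le> s"
      using False r2' unfolding A_def by simp_all
    have r3: "1.3 \<le> r"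
    proof (rule power2_le_imp_le)
      show "1.3\<^sup>2 \<le> r\<^sup>2" using bounds(2) by (simp add: power_divide)
    qed (use r in auto)
    have "1.02 * 2.3 \<le> s * (1 + r)" using bounds r3 by (intro mult_mono) auto
    then have "3.34 \<le> D" by (simp add: D_def)
    then have "1.3 * 1.71 * 3.34 \<le> r * r\<^sup>2 * D" using bounds r3 r by (intro mult_mono) auto
    moreover have "2 * A * (1 + r) \<le> 2 * 0.37 * 2.405" using bounds False r by (intro mult_mono) auto
    ultimately show ?thesis by (simp add: lambda_max_def power3_eq_cube power2_eq_square)
  qed
  then have "lambda_max * (2 * A * (1 + r)) / (lambda_max * (1 + r)\<^sup>2 * D)
      \<le> r ^ 3 * D / (lambda_max * (1 + r)\<^sup>2 * D)"
    using r D by (intro divide_right_mono) (auto simp: lambda_max_def)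
  moreover have "lambda_max * (2 * A * (1 + r)) / (lambda_max * (1 + r)\<^sup>2 * D) = 2 * A / ((1 + r) * D)"
    using r D by (simp add: lambda_max_def power2_eq_square)
  ultimately have "2 * A / ((1 + r) * D) \<le> r ^ 3 / (lambda_max * (1 + r)\<^sup>2)"
    using D by simp
  moreover have "A = r\<^sup>2 * s - 1 - s" by (simp add: A_def algebra_simps)
  ultimately show ?thesis by (simp add: D_def)
qed

text \<open>
  The terms that the recursion subtracts from the scaled \<open>b\<^sub>0\<close> are \<open>r * b2_weight r s / P\<^sub>1\<close> and
  \<open>r * q_weight k r s / P\<^sub>2\<close>, where \<open>P\<^sub>1\<close> and \<open>P\<^sub>2\<close> are the scaled pivots with index \<open>j - 2\<close> and \<open>j - 1\<close>.
\<close>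

definition b2_weight :: "real \<Rightarrow> real \<Rightarrow> real" where
  "b2_weight r s = (r * (1 + r) / (1 + s * (1 + r)))\<^sup>2 * s ^ 5 / (1 + s)\<^sup>2"

definition q_weight :: "real \<Rightarrow> real \<Rightarrow> real \<Rightarrow> real" where
  "q_weight k r s = (r / (1 + r) * q_factor k r s)\<^sup>2"

text \<open>
  For the lower bound all unknowns take the values that make the subtracted terms largest; for
  the upper bound the \<open>b2_weight\<close> term is dropped and \<open>q_factor\<close> is replaced by 1.
\<close>

lemma scaled_pivot_bounds:
  assumes rs: "0 < r" "r \<le> r_s" "0 < s" "s \<le> r_s"
    and k: "kappa_min \<le> k" "k \<le> kappa_max"
    and P1: "lambda_min \<le> P1"
    and P2: "lambda_min \<le> P2" "P2 \<le> lambda_max"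
  defines "P \<equiv> 1.99 + r * (2 / (1 + r) + 2 * s / (1 + s * (1 + r)) - b2_weight r s / P1 - q_weight k r s / P2)"
  shows "lambda_min \<le> P" and "P \<le> lambda_max"
proof -
  have lam: "0 < lambda_min" "lambda_min = 1.99" "lambda_max = 3.99" by (simp_all add: lambda_min_def lambda_max_def)
  have D: "0 < 1 + s * (1 + r)" using rs by (intro add_pos_pos) auto
  have q: "1 \<le> q_factor k r s" "q_factor k r s \<le> q_factor kappa_min r s"
    using rs k by (auto intro!: q_factor_ge_1 q_factor_antimono)
  have w2: "0 \<le> b2_weight r s" using rs unfolding b2_weight_def by simp
  have wq: "q_weight k r s \<le> q_weight kappa_min r s"
    unfolding q_weight_def using rs q by (intro power_mono mult_left_mono) auto
  have wq0: "0 \<le> q_weight k r s" by (simp add: q_weight_def)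
  have "b2_weight r s / P1 + q_weight k r s / P2 \<le> b2_weight r s / lambda_min + q_weight kappa_min r s / lambda_min"
    using w2 wq wq0 P1 P2 lam(1) by (intro add_mono frac_le) auto
  also have "\<dots> \<le> 2 / (1 + r) + 2 * s / (1 + s * (1 + r))"
    using pivot_margin[OF rs] lam(1) unfolding b2_weight_def[symmetric] q_weight_def[symmetric]
    by (simp add: add_divide_distrib[symmetric] divide_le_eq mult.commute)
  finally show "lambda_min \<le> P"
    unfolding P_def lam using rs by simp
  have "(r / (1 + r) * 1)\<^sup>2 \<le> q_weight k r s"
    unfolding q_weight_def using rs q by (intro power_mono mult_left_mono) auto
  then have "r * ((r / (1 + r))\<^sup>2 / lambda_max) \<le> r * (q_weight k r s / P2)"
    using rs P2 wq0 lam by (intro mult_left_mono frac_le) auto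
  moreover have "2 * (r\<^sup>2 * s - 1 - s) / ((1 + r) * (1 + s * (1 + r))) \<le> r * ((r / (1 + r))\<^sup>2 / lambda_max)"
    using pivot_upper_margin[OF rs] by (simp add: power_divide power2_eq_square power3_eq_cube mult_ac)
  moreover have "r * (2 / (1 + r) + 2 * s / (1 + s * (1 + r))) = 2 + 2 * (r\<^sup>2 * s - 1 - s) / ((1 + r) * (1 + s * (1 + r)))"
    using rs D by (simp add: divide_simps) algebra
  moreover have "0 \<le> r * (b2_weight r s / P1)" using rs w2 P1 lam by simp
  ultimately have "P - 1.99 \<le> 2"
    unfolding P_def right_diff_distrib by linarith
  then show "P \<le> lambda_max" by (simp add: lam)
qed

lemma b0hat_eq:
  assumes "r > 0" "s > 0" "(t::real) \<noteq> 0"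
  shows "(1 + s) * (1.99 + 3.99 * r + s * (1.99 + 7.98 * r + 5.99 * r\<^sup>2)) / (t * (1 + r) * (1 + s) * (1 + s + r * s))
       = (1.99 + r * (2 / (1 + r) + 2 * s / (1 + s * (1 + r)))) / t"
proof -
  define D c :: real where "D = 1 + s * (1 + r)" and "c = 1.99"
  have D: "D \<noteq> 0" "1 + s + r * s = D"
    using assms by (auto simp: D_def algebra_simps add_pos_pos less_imp_neq[symmetric])
  have "2 / (1 + r) + 2 * s / D = (2 + 4 * s * (1 + r)) / ((1 + r) * D)"
    using assms D by (simp add: divide_simps) (simp add: D_def algebra_simps)
  moreover have "1.99 + 3.99 * r + s * (1.99 + 7.98 * r + 5.99 * r\<^sup>2)
     = c * ((1 + r) * D) + r * (2 + 4 * s * (1 + r))"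
    by (simp add: c_def D_def field_simps power2_eq_square)
  ultimately show ?thesis
    using assms D unfolding c_def[symmetric] D_def[symmetric] by (simp add: divide_simps)
qed

section \<open>The invariant of the recursion\<close>

definition pivot_ok :: "(nat \<Rightarrow> real) \<Rightarrow> nat \<Rightarrow> bool" where
  "pivot_ok \<tau> j \<longleftrightarrow> lambda_min \<le> pseq \<tau> j * \<tau> j \<and> pseq \<tau> j * \<tau> j \<le> lambda_max"

text \<open>The number \<open>q\<^sub>j\<close> whose scaled form is given by \<open>g\<^sub>j = g\<close>.\<close>

definition q_at :: "(nat \<Rightarrow> real) \<Rightarrow> nat \<Rightarrow> real \<Rightarrow> real" where
  "q_at \<tau> j g = - ((ratio \<tau> j)\<^sup>2 / (1 + ratio \<tau> j)) * g / \<tau> j"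

context
  fixes \<tau> :: "nat \<Rightarrow> real"
  assumes steps_pos: "\<And>k. k \<ge> 1 \<Longrightarrow> \<tau> k > 0"
    and ratios: "\<And>k. k \<ge> 2 \<Longrightarrow> 0 < ratio \<tau> k" "\<And>k. k \<ge> 2 \<Longrightarrow> ratio \<tau> k \<le> r_s"
begin

lemma step_before: "k \<ge> 2 \<Longrightarrow> \<tau> (k - 1) = \<tau> k / ratio \<tau> k"
  using steps_pos[of k] steps_pos[of "k - 1"] by (simp add: ratio_def)

text \<open>
  One step of the recursion in scaled form. The number \<open>k\<close> is the correction coefficient actually
  produced by the recursion, so its two bounds are the bounds with \<open>\<mu>\<^sub>j\<close> and \<open>\<nu>\<^sub>j\<close> in disguise.
\<close>

lemma recursion_step:
  assumes p1: "pivot_ok \<tau> (Suc m)" and p2: "pivot_ok \<tau> (Suc (Suc m))"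
    and q: "qseq \<tau> (Suc (Suc m)) = q_at \<tau> (Suc (Suc m)) g"
    and g: "1 \<le> g" "g \<le> kappa_max * lambda_min"
  defines "j \<equiv> Suc (Suc (Suc m))"
  defines "k \<equiv> g / (pseq \<tau> (Suc m) * \<tau> (Suc m))"
  shows "kappa_min \<le> k" and "k \<le> kappa_max"
    and "qseq \<tau> j = q_at \<tau> j (q_factor k (ratio \<tau> j) (ratio \<tau> (j - 1)))"
    and "pivot_ok \<tau> j"
proof -
  define P1 P2 where "P1 = pseq \<tau> (Suc m) * \<tau> (Suc m)" and "P2 = pseq \<tau> (Suc (Suc m)) * \<tau> (Suc (Suc m))"
  define r s t where "r = ratio \<tau> j" and "s = ratio \<tau> (j - 1)" and "t = \<tau> j"
  have rs: "0 < r" "r \<le> r_s" "0 < s" "s \<le> r_s" and t: "0 < t"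
    using ratios[of j] ratios[of "j - 1"] steps_pos[of j] by (auto simp: r_def s_def t_def j_def)
  have \<tau>2: "\<tau> (Suc (Suc m)) = t / r" using step_before[of j] by (simp add: r_def t_def j_def)
  have \<tau>1: "\<tau> (Suc m) = t / (r * s)"
    using step_before[of "j - 1"] \<tau>2 by (simp add: s_def j_def)
  have P1: "lambda_min \<le> P1" "P1 \<le> lambda_max" and P2: "lambda_min \<le> P2" "P2 \<le> lambda_max"
    using p1 p2 by (auto simp: pivot_ok_def P1_def P2_def)
  then have pos: "0 < P1" "0 < P2" by (auto simp: lambda_min_def)
  have pm1: "pseq \<tau> (Suc m) = P1 * (r * s) / t" using rs t unfolding P1_def \<tau>1 by simp
  have pm2: "pseq \<tau> (Suc (Suc m)) = P2 * r / t" using rs t unfolding P2_def \<tau>2 by simp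
  have k_def': "k = g / P1" by (simp add: k_def P1_def)
  have "kappa_min * P1 \<le> kappa_min * lambda_max" using P1 by (intro mult_left_mono) (auto simp: kappa_min_def)
  then have "kappa_min * P1 \<le> g" using g by (simp add: kappa_min_def lambda_max_def)
  then show k1: "kappa_min \<le> k" using pos by (simp add: k_def' le_divide_eq)
  have "kappa_max * lambda_min \<le> kappa_max * P1" using P1 by (intro mult_left_mono) (auto simp: kappa_max_def)
  then show k2: "k \<le> kappa_max" using g pos by (simp add: k_def' divide_le_eq)
  define D where "D = 1 + s * (1 + r)"
  have D: "0 < D" "1 + s + r * s = D" using rs unfolding D_def by (auto intro!: add_pos_pos simp: algebra_simps)
  have b2: "b2 \<tau> j = r\<^sup>2 * s ^ 3 * (1 + r) / (t * (1 + s) * D)"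
    using rs t D unfolding b2_def Let_def r_def[symmetric] s_def[symmetric] t_def[symmetric]
    by (simp add: power2_eq_square)
  have qm: "qseq \<tau> (Suc (Suc m)) = - (s\<^sup>2 * r * g / ((1 + s) * t))"
    unfolding q q_at_def \<tau>2 using rs by (simp add: s_def j_def)
  have "qseq \<tau> (Suc (Suc m)) / pseq \<tau> (Suc m) * b2 \<tau> j = - (k * r\<^sup>2 * s ^ 4 * (1 + r) / (t * (1 + s)\<^sup>2 * D))"
    unfolding qm pm1 b2 k_def' using rs t pos D by (simp add: divide_simps) (simp add: eval_nat_numeral)
  then have "qseq \<tau> j = b1 \<tau> j + k * r\<^sup>2 * s ^ 4 * (1 + r) / (t * (1 + s)\<^sup>2 * (1 + s + r * s))"
    unfolding D j_def by simp
  also have "\<dots> = - (r\<^sup>2 / (1 + r)) * q_factor k r s / t"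
  proof -
    have "j \<noteq> 2" by (simp add: j_def)
    then show ?thesis
      using b1_plus_correction[of r s t k] rs t
      unfolding b1_def Let_def r_def[symmetric] s_def[symmetric] t_def[symmetric] by simp
  qed
  finally have qj: "qseq \<tau> j = - (r\<^sup>2 / (1 + r)) * q_factor k r s / t" .
  then show "qseq \<tau> j = q_at \<tau> j (q_factor k (ratio \<tau> j) (ratio \<tau> (j - 1)))"
    by (simp add: q_at_def r_def s_def t_def)
  have b0: "b0hat \<tau> j = (1.99 + r * (2 / (1 + r) + 2 * s / (1 + s * (1 + r)))) / t"
  proof -
    have "j \<noteq> 1" "j \<noteq> 2" by (simp_all add: j_def)
    then show ?thesis
      using b0hat_eq[of r s t] rs t
      unfolding b0hat_def Let_def r_def[symmetric] s_def[symmetric] t_def[symmetric] by simp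
  qed
  have w2: "1 / pseq \<tau> (Suc m) * (b2 \<tau> j)\<^sup>2 = r * (b2_weight r s / P1) / t"
    unfolding b2 pm1 b2_weight_def D_def[symmetric] using rs t pos D
    by (simp add: divide_simps power_mult_distrib power_divide) (simp add: eval_nat_numeral)
  have wq: "1 / pseq \<tau> (Suc (Suc m)) * (qseq \<tau> j)\<^sup>2 = r * (q_weight k r s / P2) / t"
    unfolding qj pm2 q_weight_def using rs t pos
    by (simp add: divide_simps power_mult_distrib power_divide) (simp add: eval_nat_numeral)
  have "pseq \<tau> j = b0hat \<tau> j - 1 / pseq \<tau> (Suc m) * (b2 \<tau> j)\<^sup>2 - 1 / pseq \<tau> (Suc (Suc m)) * (qseq \<tau> j)\<^sup>2"
    by (simp only: j_def pseq.simps)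
  also have "\<dots> * t = 1.99 + r * (2 / (1 + r) + 2 * s / (1 + s * (1 + r)) - b2_weight r s / P1 - q_weight k r s / P2)"
    unfolding b0 w2 wq diff_divide_distrib[symmetric] right_diff_distrib using t by simp
  finally show "pivot_ok \<tau> j"
    using scaled_pivot_bounds[OF rs k1 k2 P1(1) P2] unfolding pivot_ok_def t_def by simp
qed

lemma pivot_1: "pivot_ok \<tau> 1"
  using steps_pos[of 1] by (simp add: pivot_ok_def b0hat_def lambda_min_def lambda_max_def)

lemma qseq_2: "qseq \<tau> 2 = q_at \<tau> 2 1"
  by (simp add: numeral_2_eq_2 q_at_def b1_def)

text \<open>
  For \<open>j = 2\<close> the formulas are those of the general step with \<open>s = 0\<close>, and the
  lower bound reduces to \<open>r\<^sup>2 \<le> 3.98 * (1 + r)\<close>.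
\<close>

lemma pivot_2: "pivot_ok \<tau> 2"
proof -
  define r t where "r = ratio \<tau> 2" and "t = \<tau> 2"
  have r: "0 < r" "r \<le> 1.405" and t: "0 < t"
    using ratios[of 2] steps_pos[of 2] by (auto simp: r_def t_def r_s_def)
  have t1: "\<tau> 1 = t / r" using step_before[of 2] by (simp add: r_def t_def)
  have "pseq \<tau> 2 = b0hat \<tau> 2 - 1 / pseq \<tau> 1 * (qseq \<tau> 2)\<^sup>2"
    by (simp only: numeral_2_eq_2 pseq.simps One_nat_def)
  moreover have "b0hat \<tau> 2 = (1.99 + r * (2 / (1 + r))) / t"
    unfolding b0hat_def r_def[symmetric] t_def[symmetric] using r t
    by (simp add: divide_simps)
  moreover have "1 / pseq \<tau> 1 * (qseq \<tau> 2)\<^sup>2 = r * ((r / (1 + r))\<^sup>2 / 1.99) / t"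
  proof -
    have p1: "pseq \<tau> 1 = 1.99 * r / t" using t1 r by (simp add: b0hat_def)
    show ?thesis
      unfolding p1 qseq_2 q_at_def r_def[symmetric] t_def[symmetric] using r t
      by (simp add: divide_simps power_mult_distrib power_divide) (simp add: eval_nat_numeral)
  qed
  ultimately have "pseq \<tau> 2 * t = 1.99 + r * (2 / (1 + r)) - r * ((r / (1 + r))\<^sup>2 / 1.99)"
    using t by (simp add: left_diff_distrib)
  then have P: "pseq \<tau> 2 * \<tau> 2 = 1.99 + r * (2 / (1 + r) - (r / (1 + r))\<^sup>2 / 1.99)"
    by (simp add: t_def right_diff_distrib)
  have "r * r \<le> 2 * r" using r by (intro mult_right_mono) auto
  then have "r * (r * 100) \<le> 398 + 398 * r" using r by linarith
  then have "(r / (1 + r))\<^sup>2 / 1.99 \<le> 2 / (1 + r)"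
    using r by (simp add: divide_simps power2_eq_square)
  then have "0 \<le> r * (2 / (1 + r) - (r / (1 + r))\<^sup>2 / 1.99)" using r by simp
  moreover have "r * (2 / (1 + r) - (r / (1 + r))\<^sup>2 / 1.99) \<le> r * (2 / (1 + r) - 0)"
    using r by (intro mult_left_mono diff_left_mono) auto
  moreover have "\<dots> \<le> 2" using r by (simp add: divide_le_eq)
  ultimately show ?thesis
    unfolding pivot_ok_def P lambda_min_def lambda_max_def by simp
qed

lemma invariant:
  "pivot_ok \<tau> (Suc m) \<and> pivot_ok \<tau> (Suc (Suc m))
     \<and> (\<exists>g. 1 \<le> g \<and> g \<le> kappa_max * lambda_min \<and> qseq \<tau> (Suc (Suc m)) = q_at \<tau> (Suc (Suc m)) g)"
proof (induction m)
  case 0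
  have "pivot_ok \<tau> (Suc 0)" "pivot_ok \<tau> (Suc (Suc 0))" "qseq \<tau> (Suc (Suc 0)) = q_at \<tau> (Suc (Suc 0)) 1"
    using pivot_1 pivot_2 qseq_2 by (simp_all add: numeral_2_eq_2)
  then show ?case by (intro conjI exI[of _ 1]) (simp_all add: kappa_max_def lambda_min_def)
next
  case (Suc m)
  then obtain g where g: "1 \<le> g" "g \<le> kappa_max * lambda_min" "qseq \<tau> (Suc (Suc m)) = q_at \<tau> (Suc (Suc m)) g"
    by blast
  define j where "j = Suc (Suc (Suc m))"
  define k where "k = g / (pseq \<tau> (Suc m) * \<tau> (Suc m))"
  note step = recursion_step[OF _ _ g(3,1,2), folded j_def k_def]
  have rs: "0 < ratio \<tau> j" "ratio \<tau> j \<le> r_s" "0 < ratio \<tau> (j - 1)" "ratio \<tau> (j - 1) \<le> r_s"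
    using ratios[of j] ratios[of "j - 1"] by (auto simp: j_def)
  show ?case
    using step Suc.IH q_factor_ge_1[OF rs, of k] q_factor_le[OF rs, of k]
    unfolding j_def[symmetric] by blast
qed

lemma pivot_ok_all: "j \<ge> 1 \<Longrightarrow> pivot_ok \<tau> j"
  using invariant[of "j - 1"] by simp

text \<open>
  All three compared quantities are values of \<open>q_at\<close>, at \<open>q_factor\<close> of \<open>\<kappa>\<^bsub>min\<^esub>\<close>, of the actual
  coefficient and of \<open>\<kappa>\<^bsub>max\<^esub>\<close>; both \<open>q_at\<close> and \<open>q_factor\<close> are decreasing.
\<close>

lemma q_bounds:
  assumes "j \<ge> 3"
  shows "b1 \<tau> j + mu \<tau> j \<le> qseq \<tau> j \<and> qseq \<tau> j \<le> b1 \<tau> j + nu \<tau> j \<and> b1 \<tau> j + nu \<tau> j \<le> 0"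
proof -
  define m where "m = j - 3"
  have j: "j = Suc (Suc (Suc m))" using assms by (simp add: m_def)
  obtain g where g: "1 \<le> g" "g \<le> kappa_max * lambda_min" "qseq \<tau> (Suc (Suc m)) = q_at \<tau> (Suc (Suc m)) g"
    using invariant[of m] by blast
  define k where "k = g / (pseq \<tau> (Suc m) * \<tau> (Suc m))"
  define r s t where "r = ratio \<tau> j" and "s = ratio \<tau> (j - 1)" and "t = \<tau> j"
  have rs: "0 < r" "r \<le> r_s" "0 < s" "s \<le> r_s" and t: "0 < t"
    using ratios[of j] ratios[of "j - 1"] steps_pos[of j] by (auto simp: r_def s_def t_def j)
  have k: "kappa_min \<le> k" "k \<le> kappa_max" and q: "qseq \<tau> j = q_at \<tau> j (q_factor k r s)"
    using recursion_step[OF _ _ g(3,1,2)] invariant[of m] unfolding k_def j r_def s_def by auto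
  have corr: "b1 \<tau> j + mu \<tau> j = q_at \<tau> j (q_factor kappa_min r s)" "b1 \<tau> j + nu \<tau> j = q_at \<tau> j (q_factor kappa_max r s)"
    using b1_plus_correction[OF rs(1,3), of t] t assms
    unfolding b1_def mu_def nu_def q_at_def Let_def r_def[symmetric] s_def[symmetric] t_def[symmetric] by auto
  have mono: "q_at \<tau> j u \<le> q_at \<tau> j v" if "v \<le> u" for u v
    using that rs t unfolding q_at_def r_def[symmetric] t_def[symmetric]
    by (intro divide_right_mono mult_left_mono_neg) auto
  have "q_at \<tau> j 0 = 0" by (simp add: q_at_def)
  moreover have "0 \<le> q_factor kappa_max r s" using q_factor_ge_1[OF rs, of kappa_max] by simp
  ultimately show ?thesis
    unfolding corr q using mono q_factor_antimono[OF rs(1,3)] k by metis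
qed

end

theorem lemma3p5:
  fixes \<tau> :: "nat \<Rightarrow> real"
  assumes steps_pos: "\<forall>k\<ge>1. \<tau> k > 0"
    and ratios: "\<forall>k\<ge>2. 0 < ratio \<tau> k \<and> ratio \<tau> k \<le> r_s"
  shows "(\<forall>j\<ge>1. pseq \<tau> j \<noteq> 0)
    \<and> (\<forall>j\<ge>3. b1 \<tau> j + mu \<tau> j \<le> qseq \<tau> j
          \<and> qseq \<tau> j \<le> b1 \<tau> j + nu \<tau> j
          \<and> b1 \<tau> j + nu \<tau> j \<le> 0)
    \<and> (\<forall>j\<ge>1. lambda_min / \<tau> j \<le> pseq \<tau> j
          \<and> pseq \<tau> j \<le> lambda_max / \<tau> j)"
proof -
  have p: "pivot_ok \<tau> j" if "j \<ge> 1" for j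
    using pivot_ok_all[of \<tau> j] steps_pos ratios that by blast
  have q: "b1 \<tau> j + mu \<tau> j \<le> qseq \<tau> j \<and> qseq \<tau> j \<le> b1 \<tau> j + nu \<tau> j \<and> b1 \<tau> j + nu \<tau> j \<le> 0" if "j \<ge> 3" for j
    using q_bounds[of \<tau> j] steps_pos ratios that by blast
  have "pseq \<tau> j \<noteq> 0" "lambda_min / \<tau> j \<le> pseq \<tau> j" "pseq \<tau> j \<le> lambda_max / \<tau> j" if "j \<ge> 1" for j
    using p[OF that] steps_pos that
    by (auto simp: pivot_ok_def lambda_min_def divide_le_eq le_divide_eq)
  with q show ?thesis by blast
qed

end
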